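(* Let $k\geq 3$ and $n\geq 1$ be integers. If $n$ is not a power of $k$ (that is, $n\neq k^f$ for all integers $f\geq 0$), then $H_{k,n}$ is $2$-transitive on $\Omega_{k,n}$.
   Context: $\Omega_{k,n}=\{0,1,\ldots,kn-1\}$. Every $x\in\Omega_{k,n}$ is uniquely $x=an+b$ with $0\leq a<k$, $0\leq b<n$. Define permutations of $\Omega_{k,n}$ by $\sigma(an+b)=kb+a$ and $\rho(an+b)=((a+1)\bmod k)\,n+b$. $H_{k,n}=\langle\sigma,\rho\rangle\leq\operatorname{Sym}(\Omega_{k,n})$. A group is $2$-transitive if it is transitive on ordered pairs of distinct points. *)

theory Defs
  imports "HOL-Algebra.Bij" "HOL-Algebra.Generated_Groups"
begin

definition Omega :: "nat \<Rightarrow> nat \<Rightarrow> nat set"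
  where "Omega k n = {0..<k * n}"

(* A point x = a n + b with a < k and b < n has a = x div n and b = x mod n.
   The permutations are extensional (undefined outside Omega), as BijGroup requires. *)

definition sigma :: "nat \<Rightarrow> nat \<Rightarrow> nat \<Rightarrow> nat"
  where "sigma k n = (\<lambda>x\<in>Omega k n. k * (x mod n) + x div n)"

definition rho :: "nat \<Rightarrow> nat \<Rightarrow> nat \<Rightarrow> nat"
  where "rho k n = (\<lambda>x\<in>Omega k n. ((x div n + 1) mod k) * n + x mod n)"

definition H_group :: "nat \<Rightarrow> nat \<Rightarrow> (nat \<Rightarrow> nat) set"
  where "H_group k n = generate (BijGroup (Omega k n)) {sigma k n, rho k n}"

definition two_transitive_on :: "('a \<Rightarrow> 'a) set \<Rightarrow> 'a set \<Rightarrow> bool"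
  where "two_transitive_on G S \<longleftrightarrow>
    (\<forall>x\<in>S. \<forall>y\<in>S. \<forall>u\<in>S. \<forall>v\<in>S. x \<noteq> y \<longrightarrow> u \<noteq> v \<longrightarrow> (\<exists>g\<in>G. g x = u \<and> g y = v))"

lemma Omega_mem: "a < k \<Longrightarrow> b < n \<Longrightarrow> a * n + b \<in> Omega k n"
proof -
  assume "a < k" "b < n"
  then have "a * n + b < Suc a * n" by simp
  also have "\<dots> \<le> k * n" using \<open>a < k\<close> by (intro mult_le_mono1) simp
  finally show ?thesis by (simp add: Omega_def)
qed

lemma Omega_cases:
  assumes "x \<in> Omega k n"
  obtains a b where "a < k" "b < n" "x = a * n + b"
proof
  have "n > 0" using assms by (cases n) (auto simp: Omega_def)
  then show "x mod n < n" by simp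
  show "x div n < k" using assms by (simp add: Omega_def less_mult_imp_div_less)
  show "x = x div n * n + x mod n" by simp
qed

lemma sigma_apply:
  assumes "a < k" "b < n" shows "sigma k n (a * n + b) = k * b + a"
  using assms Omega_mem[OF assms] by (simp add: sigma_def)

lemma rho_apply:
  assumes "a < k" "b < n" shows "rho k n (a * n + b) = ((a + 1) mod k) * n + b"
  using assms Omega_mem[OF assms] by (simp add: rho_def)

lemma Bij_OmegaI:
  assumes "f \<in> extensional (Omega k n)"
    and "\<And>y. y \<in> Omega k n \<Longrightarrow> \<exists>x\<in>Omega k n. f x = y"
    and "\<And>x. x \<in> Omega k n \<Longrightarrow> f x \<in> Omega k n"
  shows "f \<in> carrier (BijGroup (Omega k n))"
proof -
  have "f ` Omega k n = Omega k n" using assms(2,3) by blast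
  then have "bij_betw f (Omega k n) (Omega k n)"
    by (simp add: Omega_def bij_betw_def eq_card_imp_inj_on)
  then show ?thesis using assms(1) by (simp add: BijGroup_def Bij_def)
qed

lemma sigma_in_BijGroup: "sigma k n \<in> carrier (BijGroup (Omega k n))"
proof (rule Bij_OmegaI)
  show "sigma k n \<in> extensional (Omega k n)" by (simp add: sigma_def)
next
  fix y assume "y \<in> Omega k n"
  then have "y \<in> Omega n k" by (simp add: Omega_def mult.commute)
  then obtain b a where "b < n" "a < k" "y = b * k + a" by (rule Omega_cases)
  then have "sigma k n (a * n + b) = y" "a * n + b \<in> Omega k n"
    by (simp_all add: sigma_apply Omega_mem)
  then show "\<exists>x\<in>Omega k n. sigma k n x = y" by blast
next
  fix x assume "x \<in> Omega k n"
  then obtain a b where ab: "a < k" "b < n" "x = a * n + b" by (rule Omega_cases)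
  then have "b * k + a \<in> Omega n k" by (intro Omega_mem)
  then show "sigma k n x \<in> Omega k n"
    using ab by (simp add: sigma_apply Omega_def mult.commute)
qed

lemma rho_in_BijGroup: "rho k n \<in> carrier (BijGroup (Omega k n))"
proof (rule Bij_OmegaI)
  show "rho k n \<in> extensional (Omega k n)" by (simp add: rho_def)
next
  fix y assume "y \<in> Omega k n"
  then obtain a b where ab: "a < k" "b < n" "y = a * n + b" by (rule Omega_cases)
  define c where "c = (a + (k - 1)) mod k"
  have "c < k" using ab(1) by (simp add: c_def)
  moreover have "(c + 1) mod k = a"
  proof -
    have "(c + 1) mod k = (a + (k - 1) + 1) mod k" by (simp only: c_def mod_add_left_eq)
    also have "a + (k - 1) + 1 = a + k" using ab(1) by linarith
    finally show ?thesis using ab(1) by simp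
  qed
  ultimately have "rho k n (c * n + b) = y" "c * n + b \<in> Omega k n"
    using ab rho_apply[of c k b n] Omega_mem[of c k b n] by simp_all
  then show "\<exists>x\<in>Omega k n. rho k n x = y" by blast
next
  fix x assume "x \<in> Omega k n"
  then obtain a b where "a < k" "b < n" "x = a * n + b" by (rule Omega_cases)
  then show "rho k n x \<in> Omega k n" by (simp add: rho_apply Omega_mem)
qed

lemma subgroup_H_group: "subgroup (H_group k n) (BijGroup (Omega k n))"
  unfolding H_group_def
  by (rule group.generate_is_subgroup[OF group_BijGroup])
    (simp add: sigma_in_BijGroup rho_in_BijGroup)

end

theory Submission
  imports Defs "HOL-Computational_Algebra.Euclidean_Algorithm"
begin

text \<open>
Write \<open>n = k\<^sup>s m\<close> with \<open>k\<close> not dividing \<open>m\<close>, so \<open>m \<ge> 2\<close>, and a card as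
\<open>x = k\<^sup>s (k c + d) + l\<close> with \<open>c < m\<close>, \<open>d < k\<close>, \<open>l < k\<^sup>s\<close>. The permutation \<open>\<rho>\<close> is
translation by \<open>n\<close> modulo \<open>kn\<close>, that is, \<open>k c + d\<close> moves to \<open>k c + d + m\<close> modulo \<open>k m\<close>, while the
conjugate of \<open>\<rho>\<close> by \<open>\<sigma>\<^sup>s\<^sup>+\<^sup>1\<close> rotates \<open>d\<close>. Because \<open>m\<close> is not divisible by \<open>k\<close>, these two do not
commute, and their commutators add \<open>1\<close> to \<open>c\<close> for one value of \<open>d\<close> and subtract \<open>1\<close> for
another. Hence the stabilizer of \<open>0\<close> can change \<open>c\<close> arbitrarily whenever \<open>d\<close> is nonzero
(with one exception, \<open>d = k/2 = m mod k\<close>).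

The low \<open>s + 1\<close> digits form a queue: \<open>\<sigma>\<close> removes the digit \<open>d\<close> at position \<open>s\<close> and inserts
\<open>(k c + d) div m\<close> at position \<open>0\<close>. Setting \<open>c = m - 1\<close> before each such step never decreases a
digit and increases it unless it is \<open>k - 1\<close>; right after a digit \<open>k - 1\<close> it also turns a zero
into a nonzero digit. So an orbit element of maximal digit sum has all digits equal to \<open>k - 1\<close>,
and every \<open>x \<noteq> 0\<close> is moved to \<open>kn - 1\<close> by the stabilizer of \<open>0\<close>.
\<close>

section \<open>Subgroups of the symmetric group on a set\<close>

lemma BijGroup_subgroup_maps:
  assumes "subgroup G (BijGroup S)" "g \<in> G" "x \<in> S"
  shows "g x \<in> S"
proof -
  have "g \<in> Bij S" using subgroup.mem_carrier[OF assms(1,2)] by (simp add: BijGroup_def)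
  then show ?thesis using assms(3) by (auto simp: Bij_def bij_betw_def)
qed

lemma BijGroup_subgroup_comp:
  assumes "subgroup G (BijGroup S)" "f \<in> G" "g \<in> G"
  shows "\<exists>h\<in>G. \<forall>x\<in>S. h x = f (g x)"
proof
  have "f \<in> Bij S" "g \<in> Bij S"
    using subgroup.mem_carrier[OF assms(1)] assms(2,3) by (auto simp: BijGroup_def)
  then show "compose S f g \<in> G"
    using subgroup.m_closed[OF assms] by (simp add: BijGroup_def)
  show "\<forall>x\<in>S. compose S f g x = f (g x)" by (simp add: compose_def)
qed

lemma BijGroup_subgroup_id:
  assumes "subgroup G (BijGroup S)"
  shows "\<exists>h\<in>G. \<forall>x\<in>S. h x = x"
  using subgroup.one_closed[OF assms] by (auto simp: BijGroup_def intro!: bexI[of _ "\<lambda>x\<in>S. x"])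

lemma BijGroup_subgroup_inv:
  assumes "subgroup G (BijGroup S)" "g \<in> G"
  shows "\<exists>h\<in>G. \<forall>x\<in>S. h (g x) = x"
proof
  have g: "g \<in> Bij S" using subgroup.mem_carrier[OF assms] by (simp add: BijGroup_def)
  show "(\<lambda>x\<in>S. inv_into S g x) \<in> G"
    using subgroup.m_inv_closed[OF assms] g by (simp add: inv_BijGroup)
  show "\<forall>x\<in>S. (\<lambda>x\<in>S. inv_into S g x) (g x) = x"
    using g BijGroup_subgroup_maps[OF assms] by (auto simp: Bij_def bij_betw_def)
qed

text \<open>Both assumptions together send every ordered pair of distinct points to
  \<open>(p, q)\<close>; one such map followed by the inverse of another joins any two
  pairs.\<close>

lemma two_transitive_onI:
  assumes G: "subgroup G (BijGroup S)"
    and trans: "\<And>x. x \<in> S \<Longrightarrow> \<exists>g\<in>G. g x = p"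
    and stab: "\<And>y. y \<in> S \<Longrightarrow> y \<noteq> p \<Longrightarrow> \<exists>g\<in>G. g p = p \<and> g y = q"
  shows "two_transitive_on G S"
proof -
  have to_pq: "\<exists>g\<in>G. g x = p \<and> g y = q" if xy: "x \<in> S" "y \<in> S" "x \<noteq> y" for x y
  proof -
    obtain g where g: "g \<in> G" "g x = p" using trans xy by blast
    have "g y \<noteq> p" using BijGroup_subgroup_inv[OF G g(1)] xy g(2) by metis
    then obtain h where h: "h \<in> G" "h p = p" "h (g y) = q"
      using stab BijGroup_subgroup_maps[OF G g(1)] xy by blast
    then show ?thesis using BijGroup_subgroup_comp[OF G h(1) g(1)] g(2) xy by metis
  qed
  show ?thesis unfolding two_transitive_on_def
  proof (intro ballI impI)
    fix x y u v assume *: "x \<in> S" "y \<in> S" "u \<in> S" "v \<in> S" "x \<noteq> y" "u \<noteq> v"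
    obtain g h where g: "g \<in> G" "g x = p" "g y = q" and h: "h \<in> G" "h u = p" "h v = q"
      using to_pq * by meson
    obtain i where i: "i \<in> G" "\<forall>x\<in>S. i (h x) = x" using BijGroup_subgroup_inv[OF G h(1)] by blast
    then have "i p = u" "i q = v" using * h by metis+
    then show "\<exists>g\<in>G. g x = u \<and> g y = v"
      using BijGroup_subgroup_comp[OF G i(1) g(1)] g * by metis
  qed
qed

lemma add_mod_less:
  fixes a b k :: nat
  assumes "a < k" "b < k" shows "(a + b) mod k = (if a + b < k then a + b else a + b - k)"
proof (cases "a + b < k")
  case False
  moreover have "a + b - k < k" using assms by linarith
  ultimately show ?thesis by (simp add: le_mod_geq)
qed simp

lemma add_mod_neq:
  fixes a b k :: nat
  assumes "a < k" "0 < b" "b < k" shows "(a + b) mod k \<noteq> a"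
  using assms by (auto simp: add_mod_less)

lemma add_div_less:
  fixes a b k :: nat
  assumes "a < k" "b < k" shows "(a + b) div k = (if a + b < k then 0 else 1)"
proof (cases "a + b < k")
  case False
  moreover have "a + b - k < k" using assms by linarith
  ultimately show ?thesis using assms by (simp add: le_div_geq)
qed simp

section \<open>Maps realized in \<open>H\<close> and orbits of the stabilizer of
  \<open>0\<close>\<close>

locale shuffle =
  fixes k s m :: nat
  assumes k3: "k \<ge> 3" and m2: "m \<ge> 2" and ndvd: "\<not> k dvd m"
begin

abbreviation n where "n \<equiv> k ^ s * m"
abbreviation \<Omega> where "\<Omega> \<equiv> Omega k n"
abbreviation H where "H \<equiv> H_group k n"

lemmas H_maps = BijGroup_subgroup_maps[OF subgroup_H_group]
lemmas H_comp = BijGroup_subgroup_comp[OF subgroup_H_group]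
lemmas H_id = BijGroup_subgroup_id[OF subgroup_H_group]
lemmas H_inv = BijGroup_subgroup_inv[OF subgroup_H_group]

lemma sigma_H: "sigma k n \<in> H" and rho_H: "rho k n \<in> H"
  unfolding H_group_def by (auto intro: generate.incl)

lemma n_pos: "n > 0" and k_pos: "k > 0"
  using k3 m2 by auto

text \<open>Equality on \<open>\<Omega>\<close> only, so that \<open>f\<close> need not be extensional.\<close>

definition realized :: "(nat \<Rightarrow> nat) \<Rightarrow> bool"
  where "realized f \<longleftrightarrow> (\<exists>g\<in>H. \<forall>x\<in>\<Omega>. g x = f x)"

lemma realized_H: "g \<in> H \<Longrightarrow> realized g"
  by (auto simp: realized_def)

lemma realized_cong: "realized f \<Longrightarrow> (\<And>x. x \<in> \<Omega> \<Longrightarrow> f x = g x) \<Longrightarrow> realized g"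
  by (auto simp: realized_def)

lemma realized_id: "realized (\<lambda>x. x)"
  using H_id by (auto simp: realized_def)

lemma realized_comp:
  assumes "realized f" "realized g" shows "realized (\<lambda>x. f (g x))"
proof -
  obtain f' g' where "f' \<in> H" "\<forall>x\<in>\<Omega>. f' x = f x" "g' \<in> H" "\<forall>x\<in>\<Omega>. g' x = g x"
    using assms by (auto simp: realized_def)
  then show ?thesis using H_comp[where f=f' and g=g'] H_maps[where g=g'] unfolding realized_def by metis
qed

text \<open>\<open>g\<close> is the conjugate of \<open>f\<close> by \<open>sigma k n\<close>,
  expressed without the inverse of \<open>sigma k n\<close>.\<close>

lemma realized_conj:
  assumes "realized f" and eq: "\<And>x. x \<in> \<Omega> \<Longrightarrow> sigma k n (f x) = g (sigma k n x)"
  shows "realized g"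
proof -
  obtain i where i: "i \<in> H" "\<forall>x\<in>\<Omega>. i (sigma k n x) = x" using H_inv[OF sigma_H] by blast
  have surj: "\<exists>z\<in>\<Omega>. sigma k n z = x" if "x \<in> \<Omega>" for x
  proof -
    have "sigma k n ` \<Omega> = \<Omega>"
      using sigma_in_BijGroup[of k n] by (simp add: BijGroup_def Bij_def bij_betw_def)
    then show ?thesis using that by (metis imageE)
  qed
  have "realized (\<lambda>x. sigma k n (f (i x)))"
    by (rule realized_comp[OF realized_H[OF sigma_H]
          realized_comp[OF assms(1) realized_H[OF i(1)]]])
  then show ?thesis
  proof (rule realized_cong)
    fix x assume "x \<in> \<Omega>"
    then obtain z where "z \<in> \<Omega>" "sigma k n z = x" using surj by blast
    then show "sigma k n (f (i x)) = g x" using i(2) eq by metis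
  qed
qed

text \<open>The orbit relation of the stabilizer of \<open>0\<close>.\<close>

definition rel0 :: "nat \<Rightarrow> nat \<Rightarrow> bool"
  where "rel0 x y \<longleftrightarrow> x \<in> \<Omega> \<and> (\<exists>g\<in>H. g 0 = 0 \<and> g x = y)"

lemma zero_\<Omega>: "0 \<in> \<Omega>"
  using n_pos k_pos by (simp add: Omega_def)

lemma rel0_\<Omega>: "rel0 x y \<Longrightarrow> x \<in> \<Omega> \<and> y \<in> \<Omega>"
  using H_maps by (auto simp: rel0_def)

lemma rel0_refl: "x \<in> \<Omega> \<Longrightarrow> rel0 x x"
  using H_id zero_\<Omega> unfolding rel0_def by metis

lemma rel0_trans [trans]:
  assumes "rel0 x y" "rel0 y z" shows "rel0 x z"
proof -
  obtain g h where "g \<in> H" "g 0 = 0" "g x = y" "h \<in> H" "h 0 = 0" "h y = z" "x \<in> \<Omega>"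
    using assms unfolding rel0_def by blast
  then show ?thesis using H_comp[where f=h and g=g] zero_\<Omega> unfolding rel0_def by metis
qed

lemma rel0_sym:
  assumes "rel0 x y" shows "rel0 y x"
proof -
  obtain g where g: "g \<in> H" "g 0 = 0" "g x = y" "x \<in> \<Omega>"
    using assms unfolding rel0_def by blast
  then show ?thesis using H_inv[where g=g] zero_\<Omega> rel0_\<Omega>[OF assms] unfolding rel0_def by metis
qed

lemma rel0_realized:
  assumes "realized f" "f 0 = 0" "x \<in> \<Omega>" shows "rel0 x (f x)"
  using assms zero_\<Omega> unfolding realized_def rel0_def by metis

lemma sigma_eq: "x \<in> \<Omega> \<Longrightarrow> sigma k n x = k * (x mod n) + x div n"
  by (simp add: sigma_def)

lemma rel0_sigma: "x \<in> \<Omega> \<Longrightarrow> rel0 x (sigma k n x)"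
  using rel0_realized[OF realized_H[OF sigma_H]] zero_\<Omega> by (simp add: sigma_eq)

lemma div_n_less: "x \<in> \<Omega> \<Longrightarrow> x div n < k"
  by (simp add: Omega_def less_mult_imp_div_less)

subsection \<open>Rotating a single digit\<close>

definition rot :: "nat \<Rightarrow> nat \<Rightarrow> nat"
  where "rot j y = k * (y div k) + (y mod k + j) mod k"

text \<open>\<open>h\<close> acts above the lowest \<open>i\<close> base-\<open>k\<close> digits,
  which stay as they are.\<close>

definition lift :: "nat \<Rightarrow> (nat \<Rightarrow> nat) \<Rightarrow> nat \<Rightarrow> nat"
  where "lift i h x = k ^ i * h (x div k ^ i) + x mod k ^ i"

lemma lift_comp: "lift i h (lift i h' x) = lift i (\<lambda>y. h (h' y)) x"
  using k_pos by (simp add: lift_def)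

lemma rot_div: "rot j y div k = y div k" and rot_mod_k: "rot j y mod k = (y mod k + j) mod k"
  using k_pos by (simp_all add: rot_def)

lemma rot_rot: "rot i (rot j y) = rot (i + j) y"
  by (simp add: rot_def[of i] rot_def[of "i + j"] rot_div rot_mod_k mod_simps add_ac)
    (metis add.assoc mod_add_right_eq)

text \<open>As \<open>k ^ i\<close> divides \<open>n\<close>, reduction modulo \<open>n\<close>
  spares the lowest \<open>i\<close> digits; the factor \<open>k\<close> moves them up one place,
  and \<open>x div n\<close> fills the freed one.\<close>

lemma sigma_div:
  assumes "x \<in> \<Omega>" "i \<le> s"
  shows "sigma k n x div k ^ Suc i = x div k ^ i mod (k ^ (s - i) * m)"
    and "sigma k n x mod k ^ Suc i = k * (x mod k ^ i) + x div n"
proof -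
  have n: "n = k ^ i * (k ^ (s - i) * m)"
    using assms(2) by (simp flip: power_add mult.assoc)
  have 1: "sigma k n x = k * (x mod n) + x div n" "x div n < k"
    using assms sigma_eq div_n_less by auto
  have 2: "x mod n = k ^ i * (x div k ^ i mod (k ^ (s - i) * m)) + x mod k ^ i"
    unfolding n by (rule mod_mult2_eq)
  have 3: "k * (x mod k ^ i) + x div n < k ^ Suc i"
  proof -
    have "x mod k ^ i < k ^ i" using k_pos by simp
    then have "k * (x mod k ^ i + 1) \<le> k * k ^ i" by (intro mult_le_mono2) simp
    then show ?thesis using 1(2) by simp
  qed
  have 4: "sigma k n x = k ^ Suc i * (x div k ^ i mod (k ^ (s - i) * m)) + (k * (x mod k ^ i) + x div n)"
    unfolding 1(1) 2 by (simp add: algebra_simps)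
  show "sigma k n x div k ^ Suc i = x div k ^ i mod (k ^ (s - i) * m)"
    unfolding 4 using 3 k_pos by (simp del: power_Suc)
  show "sigma k n x mod k ^ Suc i = k * (x mod k ^ i) + x div n"
    unfolding 4 using 3 by (simp del: power_Suc)
qed

lemma mult_add_less:
  fixes a b c d :: nat
  assumes "b < d" "a < c" shows "d * a + b < d * c"
proof -
  have "d * a + b < d * Suc a" using assms by simp
  also have "\<dots> \<le> d * c" using assms by (intro mult_le_mono2) simp
  finally show ?thesis .
qed

lemma \<Omega>_iff: "i \<le> s \<Longrightarrow> x \<in> \<Omega> \<longleftrightarrow> x div k ^ i < k * (k ^ (s - i) * m)"
proof -
  assume "i \<le> s"
  then have "k ^ s = k ^ (s - i) * k ^ i"
    by (simp flip: power_add)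
  then have "k * n = (k * (k ^ (s - i) * m)) * k ^ i"
    by (simp add: ac_simps)
  moreover have "0 < k ^ i" using k_pos by simp
  ultimately show ?thesis by (simp only: Omega_def div_less_iff_less_mult atLeastLessThan_iff) simp
qed

lemma rot_less: "y < k * M \<Longrightarrow> rot j y < k * M"
  unfolding rot_def using k_pos
  by (intro mult_add_less) (auto simp: less_mult_imp_div_less mult.commute)

lemma rot_mod: assumes "k dvd M" shows "rot j y mod M = rot j (y mod M)" and "rot j y div M = y div M"
proof -
  obtain N where M: "M = k * N" using assms by blast
  have "y mod (k * N) div k = y div k mod N" "y mod (k * N) mod k = y mod k"
    using k_pos by (simp_all add: mod_mult2_eq)
  then show "rot j y mod M = rot j (y mod M)" "rot j y div M = y div M"
    by (simp_all add: M mod_mult2_eq div_mult2_eq rot_div rot_mod_k rot_def[of j "k * _ + _"])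
qed

text \<open>\<open>rho\<close> cycles the quotient by \<open>n\<close>, which \<open>sigma\<close>
  turns into the lowest digit. Each further conjugation by \<open>sigma\<close> moves the rotated
  digit up one place, as long as \<open>k\<close> divides \<open>k ^ (s - i) * m\<close>.\<close>

lemma realized_rot:
  assumes "i \<le> s" shows "realized (lift i (rot 1))"
  using assms
proof (induction i)
  case 0
  show ?case
  proof (rule realized_conj[OF realized_H[OF rho_H]])
    fix x assume "x \<in> \<Omega>"
    then obtain a b where ab: "a < k" "b < n" "x = a * n + b" by (rule Omega_cases)
    have "(a + 1) mod k < k" using k_pos by simp
    then have "sigma k n (rho k n x) = k * b + (a + 1) mod k"
      unfolding ab(3) rho_apply[OF ab(1,2)] using ab(2) by (rule sigma_apply)
    moreover have "sigma k n x = k * b + a" using ab by (simp only: sigma_apply)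
    ultimately show "sigma k n (rho k n x) = lift 0 (rot 1) (sigma k n x)"
      using ab(1) by (simp add: lift_def rot_def)
  qed
next
  case (Suc i)
  then have i: "i \<le> s" "i < s" by auto
  let ?M = "k ^ (s - i) * m"
  have dvd: "k dvd ?M" using i by (simp add: dvd_power)
  have n: "n = k ^ i * ?M" using i by (simp flip: power_add mult.assoc)
  show ?case
  proof (rule realized_conj)
    show "realized (lift i (rot 1))" using Suc.IH i by simp
    fix x assume x: "x \<in> \<Omega>"
    define x' where "x' = lift i (rot 1) x"
    have x': "x' div k ^ i = rot 1 (x div k ^ i)" "x' mod k ^ i = x mod k ^ i"
      using k_pos by (simp_all add: x'_def lift_def)
    then have x'\<Omega>: "x' \<in> \<Omega>"
      using x by (simp add: \<Omega>_iff[OF i(1)] rot_less)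
    have dn: "x' div n = x div n"
      unfolding n div_mult2_eq[of _ "k ^ i"] x' rot_mod(2)[OF dvd] ..
    have "sigma k n x' = k ^ Suc i * (sigma k n x' div k ^ Suc i) + sigma k n x' mod k ^ Suc i"
      by (rule mult_div_mod_eq[symmetric])
    also have "\<dots> = lift (Suc i) (rot 1) (sigma k n x)"
      unfolding lift_def sigma_div[OF x'\<Omega> i(1)] sigma_div[OF x i(1)] x' dn rot_mod(1)[OF dvd] ..
    finally show "sigma k n (lift i (rot 1) x) = lift (Suc i) (rot 1) (sigma k n x)"
      by (simp add: x'_def)
  qed
qed

lemma realized_lift_rot:
  assumes "i \<le> s" shows "realized (lift i (rot j))"
proof (induction j)
  case 0
  have "lift i (rot 0) x = x" for x by (simp add: lift_def rot_def)
  then show ?case using realized_cong[OF realized_id] by simp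
next
  case (Suc j)
  have "lift i (rot (Suc j)) x = lift i (rot 1) (lift i (rot j) x)" for x
    by (simp add: lift_comp rot_rot)
  then show ?case using realized_cong[OF realized_comp[OF realized_rot[OF assms] Suc]] by simp
qed

lemma realized_lift_rho: "realized (lift s (\<lambda>y. (y + m) mod (k * m)))"
proof (rule realized_cong[OF realized_H[OF rho_H]])
  fix x assume x: "x \<in> \<Omega>"
  have "rho k n x = ((x div n + 1) mod k) * n + x mod n" using x by (simp add: rho_def)
  also have "\<dots> = (x + n) mod (n * k)"
  proof -
    have "(x + n) div n = x div n + 1" by (rule div_add_self2) (use n_pos in simp)
    then show ?thesis unfolding mod_mult2_eq[of "x + n" n k] by (simp only: mod_add_self2 mult.commute)
  qed
  also have "n * k = k ^ s * (k * m)" by simp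
  also have "(x + n) mod \<dots> = lift s (\<lambda>y. (y + m) mod (k * m)) x"
    unfolding mod_mult2_eq[of "x + n"] using k_pos by (simp add: lift_def add.commute)
  finally show "rho k n x = lift s (\<lambda>y. (y + m) mod (k * m)) x" .
qed

subsection \<open>Shifting residue classes independently\<close>

text \<open>For \<open>y = k c + d\<close> the entry \<open>v d\<close> is added to \<open>c\<close>
  modulo \<open>m\<close>, so composing shifts adds their vectors.\<close>

definition shift :: "(nat \<Rightarrow> int) \<Rightarrow> nat \<Rightarrow> nat"
  where "shift v y = k * nat ((int (y div k) + v (y mod k)) mod int m) + y mod k"

definition shifts :: "(nat \<Rightarrow> int) set"
  where "shifts = {v. realized (lift s (shift v))}"

lemma shift_div: "int (shift v y div k) = (int (y div k) + v (y mod k)) mod int m"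
  and shift_mod: "shift v y mod k = y mod k"
  using k_pos m2 by (simp_all add: shift_def)

lemma shifts_cong:
  assumes "v \<in> shifts" "\<And>e. e < k \<Longrightarrow> v e mod int m = w e mod int m"
  shows "w \<in> shifts"
proof -
  have "shift v y = shift w y" for y
  proof -
    have "(int (y div k) + v (y mod k)) mod int m = (int (y div k) + w (y mod k)) mod int m"
      using assms(2) k_pos by (intro mod_add_cong) auto
    then show ?thesis by (simp add: shift_def)
  qed
  then have "shift v = shift w" by blast
  then show ?thesis using assms(1) by (simp add: shifts_def)
qed

lemma shifts_add:
  assumes "v \<in> shifts" "w \<in> shifts" shows "(\<lambda>e. v e + w e) \<in> shifts"
proof -
  have "shift v (shift w y) = shift (\<lambda>e. v e + w e) y" for y
    by (simp add: shift_def[of v] shift_def[of "\<lambda>e. v e + w e"] shift_div shift_mod mod_simps add_ac)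
  then show ?thesis
    using realized_comp[of "lift s (shift v)" "lift s (shift w)"] assms
    by (simp add: shifts_def lift_comp)
qed

lemma shifts_mult:
  assumes "v \<in> shifts" shows "(\<lambda>e. t * v e) \<in> shifts"
proof -
  have nat: "(\<lambda>e. int j * v e) \<in> shifts" for j
  proof (induction j)
    case 0
    have "lift s (shift (\<lambda>e. 0)) x = x" if "x \<in> \<Omega>" for x
    proof -
      have "x div k ^ s div k < m"
        using that \<Omega>_iff[of s x] by (simp add: less_mult_imp_div_less mult.commute)
      then have "nat (int (x div k ^ s div k) mod int m) = x div k ^ s div k" by simp
      then show ?thesis by (simp add: lift_def shift_def)
    qed
    then show ?case using realized_cong[OF realized_id] by (simp add: shifts_def)
  next
    case (Suc j)
    show ?case using shifts_add[OF assms Suc] by (simp add: algebra_simps)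
  qed
  \<comment> \<open>Only residues modulo \<open>m\<close> matter, so a negative \<open>t\<close>
    becomes a natural number.\<close>
  show ?thesis
    by (rule shifts_cong[OF nat[of "nat (t mod int m)"]]) (use m2 in \<open>simp add: mod_simps\<close>)
qed

lemma shifts_cyclic:
  assumes "v \<in> shifts" shows "(\<lambda>e. v ((e + j) mod k)) \<in> shifts"
proof -
  \<comment> \<open>This is \<open>- j\<close> modulo \<open>k\<close>: the shift is conjugated by a
    rotation of \<open>d\<close>.\<close>
  let ?j = "j * (k - 1)"
  have jj: "(e + (j + ?j)) mod k = e mod k" for e
  proof -
    have "j + ?j = j * k" using k_pos by (cases k) auto
    then show ?thesis by simp
  qed
  have "rot ?j (shift v (rot j y)) = shift (\<lambda>e. v ((e + j) mod k)) y" for y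
  proof -
    note r = rot_div[of j y] rot_mod_k[of j y]
    have "shift v (rot j y) div k = nat ((int (y div k) + v ((y mod k + j) mod k)) mod int m)"
      using shift_div[of v "rot j y"] unfolding r by linarith
    moreover have "((y mod k + j) mod k + ?j) mod k = y mod k"
      using jj[of "y mod k"] by (metis add.assoc mod_add_left_eq mod_mod_trivial)
    ultimately show ?thesis
      unfolding rot_def[of ?j] shift_mod r(2) by (simp only: shift_def)
  qed
  then show ?thesis
    using realized_comp[OF realized_lift_rot[OF order_refl, of ?j] realized_comp[OF _ realized_lift_rot[OF order_refl, of j]], of "lift s (shift v)"] assms
    by (simp add: shifts_def lift_comp)
qed

text \<open>The translation \<open>\<rho>\<close> followed by the rotation of \<open>d\<close> by \<open>- m\<close>.\<close>

lemma shifts_carry: "(\<lambda>e. int ((e + m) div k)) \<in> shifts"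
proof -
  let ?j = "m * (k - 1)"
  have "rot ?j ((y + m) mod (k * m)) = shift (\<lambda>e. int ((e + m) div k)) y" for y
  proof -
    have "m + ?j = m * k" using k_pos by (cases k) auto
    then have "(y + m + ?j) mod k = y mod k" by (simp add: add.assoc)
    moreover have "(y + m) div k = y div k + (y mod k + m) div k"
      using div_mult_self1[of k "y mod k + m" "y div k"] k_pos
      by (metis add.assoc add.commute div_mult_self3 less_numeral_extra(3) mod_div_mult_eq)
    ultimately show ?thesis using k_pos
      by (simp add: rot_def shift_def mod_mult2_eq mod_simps nat_mod_distrib flip: of_nat_add of_nat_mod)
  qed
  then show ?thesis
    using realized_comp[OF realized_lift_rot[OF order_refl, of ?j] realized_lift_rho]
    by (simp add: shifts_def lift_comp)
qed

abbreviation r where "r \<equiv> m mod k"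
abbreviation q where "q \<equiv> m div k"

lemma r_pos: "0 < r" and r_less: "r < k" and m_eq: "m = k * q + r"
  using ndvd k_pos by (auto simp: dvd_eq_mod_eq_0)

lemma mod_eq_shift:
  assumes "j < k" shows "(a + (k - j)) mod k = 0 \<longleftrightarrow> a mod k = j"
proof -
  define b where "b = a mod k"
  have b: "b < k" using k_pos by (simp add: b_def)
  have "(b + (k - j)) mod k = 0 \<longleftrightarrow> b = j"
  proof (cases "b < j")
    case True
    then show ?thesis using assms by simp
  next
    case False
    then have "b + (k - j) = (b - j) + k" using assms by linarith
    then have "(b + (k - j)) mod k = (b - j) mod k" by (simp only: mod_add_self2)
    then show ?thesis using False b by simp
  qed
  then show ?thesis by (simp add: b_def mod_simps)
qed

text \<open>The carry vector minus its cyclic translate is a discrete derivative: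
  \<open>(e + m) div k\<close> grows by one exactly when \<open>k\<close> divides
  \<open>e + m\<close>, and the wrap-around from \<open>k - 1\<close> to \<open>0\<close>
  contributes the \<open>- 1\<close>. A further cyclic translate replaces \<open>0\<close> by
  \<open>j\<close>.\<close>

lemma shifts_unit:
  assumes "j < k"
  shows "(\<lambda>e. of_bool ((e + r) mod k = j) - of_bool (e = j)) \<in> shifts"
proof -
  define f where "f e = int ((e + m) div k)" for e
  have "(\<lambda>e. f e + (-1) * f ((e + (k - 1)) mod k)) \<in> shifts"
    using shifts_add[OF shifts_carry shifts_mult[OF shifts_cyclic[OF shifts_carry]]]
    unfolding f_def by blast
  then have 0: "(\<lambda>e. of_bool ((e + r) mod k = 0) - of_bool (e = 0)) \<in> shifts"
  proof (rule shifts_cong)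
    fix e assume e: "e < k"
    have "f e + (-1) * f ((e + (k - 1)) mod k) = of_bool ((e + r) mod k = 0) - of_bool (e = 0)"
    proof (cases e)
      case 0
      have "k - 1 + m = (k - 1 + r) + k * q" using m_eq by linarith
      then have "(k - 1 + m) div k = (k - 1 + r + k * q) div k" by (simp only:)
      also have "\<dots> = q + (k - 1 + r) div k" by (rule div_mult_self2) (use k_pos in simp)
      also have "(k - 1 + r) div k = 1"
        using add_div_less[of "k - 1" k r] k_pos r_pos r_less by simp
      finally show ?thesis using 0 r_pos k_pos by (simp add: f_def)
    next
      case (Suc e')
      then have e': "(e + (k - 1)) mod k = e'" using e by (simp add: mod_if)
      have "(e + m) mod k = (e + r) mod k" by (simp add: mod_simps)
      then have "f e = f e' + of_bool ((e + r) mod k = 0)"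
        using div_Suc[of "e' + m" k] by (simp add: f_def Suc)
      then show ?thesis unfolding e' by (simp add: Suc)
    qed
    then show "(f e + (-1) * f ((e + (k - 1)) mod k)) mod int m =
      (of_bool ((e + r) mod k = 0) - of_bool (e = 0)) mod int m" by simp
  qed
  show ?thesis
  proof (rule shifts_cong[OF shifts_cyclic[OF 0, of "k - j"]])
    fix e assume e: "e < k"
    have "((e + (k - j)) mod k + r) mod k = ((e + r) + (k - j)) mod k"
      by (simp add: mod_simps add_ac)
    then show "(of_bool (((e + (k - j)) mod k + r) mod k = 0) - of_bool ((e + (k - j)) mod k = 0)) mod int m
      = (of_bool ((e + r) mod k = j) - of_bool (e = j)) mod int m"
      using mod_eq_shift[OF assms, of "e + r"] mod_eq_shift[OF assms, of e] e by simp
  qed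
qed

text \<open>
If \<open>k = 2 r\<close>, a vector in \<open>shifts\<close> vanishing at \<open>0\<close> has at \<open>r\<close> a multiple of \<open>2 q + 1\<close>, a divisor
of \<open>m\<close>; this is why \<open>r\<close> is excluded unless \<open>q = 0\<close>.
\<close>

definition free :: "nat \<Rightarrow> bool"
  where "free d \<longleftrightarrow> 0 < d \<and> d < k \<and> \<not> (2 * r = k \<and> k < m \<and> d = r)"

text \<open>If \<open>d\<close> is not \<open>r\<close>, the negative of \<open>shifts_unit\<close>
  at \<open>d\<close> works; if \<open>d = r\<close>, its instance at \<open>2 r mod k\<close> does,
  unless \<open>2 r = k\<close>; in that case \<open>m < k\<close>, and the carry vector itself
  works.\<close>

lemma free_shift:
  assumes "free d" shows "\<exists>v\<in>shifts. v 0 = 0 \<and> v d = 1"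
proof -
  have d: "0 < d" "d < k" using assms by (auto simp: free_def)
  consider "d \<noteq> r" | "d = r" "2 * r \<noteq> k" | "d = r" "2 * r = k" "m < k"
    using assms ndvd by (metis dvd_refl free_def linorder_neqE_nat)
  then show ?thesis
  proof cases
    case 1
    have "(d + r) mod k \<noteq> d" by (rule add_mod_neq[OF d(2) r_pos r_less])
    then show ?thesis using 1 d r_less
      by (intro bexI[OF _ shifts_mult[OF shifts_unit[OF d(2)], of "-1"]]) simp
  next
    case 2
    let ?j = "(r + r) mod k"
    have "?j < k" using k_pos by simp
    moreover have "?j \<noteq> 0" using 2 r_pos add_mod_less[OF r_less r_less] by (auto split: if_splits)
    moreover have "?j \<noteq> r" by (rule add_mod_neq[OF r_less r_pos r_less])
    ultimately show ?thesis using 2 r_less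
      by (intro bexI[OF _ shifts_unit[of ?j]]) auto
  next
    case 3
    then have "d + m = k" by simp
    then have "(d + m) div k = 1" using k_pos by simp
    then show ?thesis using 3(3) by (intro bexI[OF _ shifts_carry]) simp
  qed
qed

text \<open>The carry vector is \<open>q\<close> at \<open>0\<close> and \<open>q + 1\<close> at
  \<open>r\<close>, where \<open>shifts_unit\<close> at \<open>r\<close> is \<open>1\<close> and
  \<open>- 1\<close>; subtracting the latter \<open>q\<close> times clears the entry at
  \<open>0\<close>.\<close>

lemma half_shift:
  assumes "2 * r = k" shows "\<exists>v\<in>shifts. v 0 = 0 \<and> v r = int (2 * q + 1)"
proof -
  have "(r + m) div k = q + 1"
  proof -
    have "r + m = k * q + 2 * r" using m_eq by linarith
    then have "r + m = (q + 1) * k" unfolding assms by (simp add: algebra_simps)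
    then show ?thesis using k_pos by simp
  qed
  moreover have "(r + r) mod k = 0" using assms by (metis mult_2 mod_self)
  ultimately show ?thesis
    using shifts_add[OF shifts_carry shifts_mult[OF shifts_unit[OF r_less], of "- int q"]] r_pos r_less
    by (intro bexI) auto
qed

subsection \<open>The top part of a card number\<close>

definition dig :: "nat \<Rightarrow> nat \<Rightarrow> nat"
  where "dig i x = x div k ^ i mod k"

text \<open>In the coordinates \<open>x = k^s (k c + d) + l\<close> this is \<open>c\<close>, while
  \<open>dig s x\<close> is \<open>d\<close>.\<close>

definition hi :: "nat \<Rightarrow> nat"
  where "hi x = x div k ^ Suc s"

definition put :: "nat \<Rightarrow> nat \<Rightarrow> nat"
  where "put c x = k ^ s * (k * c + dig s x) + x mod k ^ s"

lemma dig_less: "dig i x < k"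
  using k_pos by (simp add: dig_def)

lemma hi_eq: "hi x = x div k ^ s div k"
  by (simp add: hi_def mult.commute[of k "k ^ s"] flip: div_mult2_eq)

lemma div_dig: "x div k ^ s = k * hi x + dig s x"
  by (simp add: hi_eq dig_def)

lemma div_n_eq: "x div n = (k * hi x + dig s x) div m"
  by (simp add: div_mult2_eq div_dig)

lemma put_div: "put c x div k ^ s = k * c + dig s x" and put_mod: "put c x mod k ^ s = x mod k ^ s"
  using k_pos by (simp_all add: put_def)

lemma put_\<Omega>: "c < m \<Longrightarrow> put c x \<in> \<Omega>"
  using \<Omega>_iff[of s "put c x"] by (simp add: put_div mult_add_less dig_less)

lemma hi_put: "hi (put c x) = c"
  using dig_less[of s x] by (simp add: hi_eq put_div)

lemma dig_put:
  assumes "i \<le> s" shows "dig i (put c x) = dig i x"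
proof -
  have dig: "dig i y = y mod k ^ Suc i div k ^ i" for y
    using k_pos by (simp add: dig_def mod_mult2_eq mult.commute[of k "k ^ i"])
  have "put c x mod k ^ Suc s = x mod k ^ Suc s"
    using k_pos by (simp add: mod_mult2_eq mult.commute[of k "k ^ s"] put_div put_mod dig_def)
  moreover have "k ^ Suc i dvd k ^ Suc s" using assms by (intro le_imp_power_dvd) simp
  ultimately have "put c x mod k ^ Suc i = x mod k ^ Suc i" by (metis mod_mod_cancel)
  then show ?thesis by (simp add: dig)
qed

lemma rel0_put:
  assumes "v \<in> shifts" "v 0 = 0" "x \<in> \<Omega>" "c < m"
    and eq: "int c = int (hi x) + t * v (dig s x)"
  shows "rel0 x (put c x)"
proof -
  let ?w = "\<lambda>e. t * v e"
  have w: "?w \<in> shifts" "?w 0 = 0" using shifts_mult assms(1,2) by auto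
  have "rel0 x (lift s (shift ?w) x)"
  proof (rule rel0_realized[OF _ _ assms(3)])
    show "realized (lift s (shift ?w))" using w(1) by (simp add: shifts_def)
    show "lift s (shift ?w) 0 = 0" by (simp add: lift_def shift_def assms(2))
  qed
  also have "lift s (shift ?w) x = put c x"
    using eq assms(4) k_pos dig_less[of s x]
    by (simp add: lift_def shift_def put_def div_dig flip: eq)
  finally show ?thesis .
qed

lemma rel0_put_free:
  assumes "x \<in> \<Omega>" "c < m" "free (dig s x)" shows "rel0 x (put c x)"
proof -
  obtain v where "v \<in> shifts" "v 0 = 0" "v (dig s x) = 1" using free_shift assms by blast
  then show ?thesis using rel0_put[of v x c "int c - int (hi x)"] assms by simp
qed

section \<open>The digit queue and the weight argument\<close>

lemma dig_0_sigma: "x \<in> \<Omega> \<Longrightarrow> dig 0 (sigma k n x) = x div n"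
  using sigma_div(2)[of x 0] by (simp add: dig_def)

lemma dig_Suc_sigma:
  assumes "x \<in> \<Omega>" "i < s" shows "dig (Suc i) (sigma k n x) = dig i x"
proof -
  have "k dvd k ^ (s - i) * m" using assms by (simp add: dvd_power)
  then show ?thesis
    using sigma_div(1)[of x i] assms by (simp add: dig_def mod_mod_cancel)
qed

lemma hi_sigma: "x \<in> \<Omega> \<Longrightarrow> hi (sigma k n x) = (k * hi x + dig s x) mod m"
  using sigma_div(1)[of x s] by (simp add: hi_def[of "sigma k n x"] div_dig)

text \<open>The exceptional digit counts as \<open>0\<close>, so that dropping a digit that cannot
  be steered never lowers the weight.\<close>

definition wt :: "nat \<Rightarrow> nat"
  where "wt d = (if free d then d else 0)"

definition weight :: "nat \<Rightarrow> nat"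
  where "weight x = (\<Sum>i\<le>s. wt (dig i x))"

lemma weight_sigma:
  assumes "x \<in> \<Omega>" shows "weight (sigma k n x) + wt (dig s x) = weight x + wt (x div n)"
proof -
  have "weight (sigma k n x) = wt (x div n) + (\<Sum>i<s. wt (dig i x))"
    using assms by (simp add: weight_def sum.atMost_shift dig_0_sigma dig_Suc_sigma)
  moreover have "weight x = (\<Sum>i<s. wt (dig i x)) + wt (dig s x)"
    by (simp add: weight_def flip: lessThan_Suc_atMost)
  ultimately show ?thesis by simp
qed

lemma weight_put: "weight (put c x) = weight x"
  by (simp add: weight_def dig_put)

text \<open>One queue step, with \<open>c\<close> first set to its maximum whenever the digit allows
  it.\<close>

definition adv :: "nat \<Rightarrow> nat"
  where "adv x = sigma k n (if free (dig s x) then put (m - 1) x else x)"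

lemma rel0_adv:
  assumes "x \<in> \<Omega>" shows "rel0 x (adv x)"
proof -
  have "rel0 x (if free (dig s x) then put (m - 1) x else x)" (is "rel0 x ?y")
    using assms rel0_refl rel0_put_free m2 by simp
  then show ?thesis using rel0_sigma[of ?y] rel0_\<Omega> rel0_trans unfolding adv_def by blast
qed

lemma dig_adv: "x \<in> \<Omega> \<Longrightarrow> i < s \<Longrightarrow> dig (Suc i) (adv x) = dig i x"
  using m2 by (auto simp: adv_def dig_Suc_sigma put_\<Omega> dig_put)

lemma top_digit_less: "e < k \<Longrightarrow> (k * (m - 1) + e) div m < k"
  using mult_add_less[of e k "m - 1" m] m2 by (simp add: less_mult_imp_div_less)

lemma top_digit_ge:
  assumes "e < k" shows "e \<le> (k * (m - 1) + e) div m"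
proof -
  obtain M where M: "m = Suc M" using m2 by (cases m) auto
  have "e * M \<le> k * M" using assms by simp
  then show ?thesis by (simp add: M less_eq_div_iff_mult_less_eq)
qed

text \<open>The claim amounts to \<open>m \<le> (k - e) * (m - 1)\<close>, which follows from
  \<open>k - e \<ge> 2\<close> and \<open>m \<ge> 2\<close>.\<close>

lemma top_digit_gr:
  assumes "Suc e < k" shows "e < (k * (m - 1) + e) div m"
proof -
  obtain M where M: "m = Suc M" "M \<ge> 1" using m2 by (cases m) auto
  have "(e + 2) * M \<le> k * M" using assms by (intro mult_le_mono1) simp
  then have "Suc e * Suc M \<le> k * M + e" using M(2) by (simp add: algebra_simps)
  then have "Suc e \<le> (k * M + e) div Suc M" by (simp add: less_eq_div_iff_mult_less_eq del: mult_Suc mult_Suc_right)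
  then show ?thesis by (simp add: M)
qed

lemma free_top_digit:
  assumes "e < k" shows "free ((k * (m - 1) + e) div m)"
proof -
  let ?a = "(k * (m - 1) + e) div m"
  have "0 < ?a"
  proof (cases "e = 0")
    case True then show ?thesis using top_digit_gr[of 0] k3 by simp
  next
    case False then show ?thesis using top_digit_ge[OF assms] by linarith
  qed
  \<comment> \<open>For \<open>k < m\<close> the digit is at least \<open>k - 1\<close>, which
    exceeds \<open>r = k / 2\<close>.\<close>
  moreover have "?a \<noteq> r" if "2 * r = k" "k < m"
  proof -
    obtain M where M: "m = Suc M" using m2 by (cases m) auto
    obtain l where l: "k = Suc l" using k_pos by (cases k) auto
    have "l * m \<le> k * (m - 1)" using that(2) by (simp add: M l)
    then have "l \<le> ?a" using m2 by (simp add: less_eq_div_iff_mult_less_eq)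
    then show ?thesis using that(1) l k3 by auto
  qed
  ultimately show ?thesis using top_digit_less[OF assms] by (auto simp: free_def)
qed

lemma weight_adv_free:
  assumes "x \<in> \<Omega>" "free (dig s x)"
  shows "weight x \<le> weight (adv x)" and "weight (adv x) = weight x \<Longrightarrow> dig s x = k - 1"
    and "dig s x = k - 1 \<Longrightarrow> hi (adv x) = m - 1"
proof -
  let ?y = "put (m - 1) x" and ?d = "dig s x"
  have y: "?y \<in> \<Omega>" using put_\<Omega> m2 by simp
  have "weight (adv x) + wt ?d = weight x + wt ((k * (m - 1) + ?d) div m)"
    using weight_sigma[OF y] assms(2) by (simp add: adv_def weight_put dig_put div_n_eq hi_put)
  then have w: "weight (adv x) + ?d = weight x + (k * (m - 1) + ?d) div m"
    using assms(2) free_top_digit[OF dig_less] by (simp add: wt_def)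
  then show "weight x \<le> weight (adv x)" using top_digit_ge[OF dig_less, of s x] by linarith
  show "weight (adv x) = weight x \<Longrightarrow> ?d = k - 1"
    using w top_digit_gr[of ?d] dig_less[of s x] by linarith
  show "hi (adv x) = m - 1" if "?d = k - 1"
  proof -
    \<comment> \<open>Both sides are \<open>k * m - 1\<close>, so the top part stays at its
      maximum.\<close>
    have "k * (m - 1) + (k - 1) = (k - 1) * m + (m - 1)"
      using k_pos m2 by (cases k; cases m) auto
    then have "(k * (m - 1) + (k - 1)) mod m = (m - 1) mod m" by (simp only: mod_mult_self3)
    then have "(k * (m - 1) + (k - 1)) mod m = m - 1" using m2 by simp
    then show ?thesis using that assms(2) y by (simp add: adv_def hi_sigma dig_put hi_put)
  qed
qed

lemma weight_adv_not_free:
  assumes "x \<in> \<Omega>" "\<not> free (dig s x)"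
  shows "weight (adv x) = weight x + wt (x div n)"
  using weight_sigma[OF assms(1)] assms(2) by (simp add: adv_def wt_def)

lemma mod_power_all_top:
  assumes "\<And>i. i < j \<Longrightarrow> dig i x = k - 1" shows "x mod k ^ j + 1 = k ^ j"
  using assms
proof (induction j)
  case (Suc j)
  have "x mod k ^ Suc j = k ^ j * (k - 1) + x mod k ^ j"
    using Suc.prems[of j] by (simp add: mod_mult2_eq mult.commute[of k "k ^ j"] dig_def)
  then show ?case using Suc k_pos by (cases k) auto
qed simp

text \<open>\<open>adv\<close> preserves the set \<open>Q\<close> of orbit elements of maximal
  weight. Inside \<open>Q\<close> a free digit at position \<open>s\<close> must be
  \<open>k - 1\<close> and must be followed by another free digit, so from then on every digit
  reaching position \<open>s\<close> is \<open>k - 1\<close>.\<close>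

lemma rel0_top:
  assumes x: "x \<in> \<Omega>" and i: "i \<le> s" "free (dig i x)"
  shows "rel0 x (k * n - 1)"
proof -
  define W where "W = weight ` {y. rel0 x y}"
  have "finite {y. rel0 x y}"
    by (rule finite_subset[of _ \<Omega>]) (auto simp: Omega_def dest: rel0_\<Omega>)
  then have W: "finite W" "W \<noteq> {}" using rel0_refl[OF x] by (auto simp: W_def)
  obtain y where y: "rel0 x y" "weight y = Max W" using Max_in[OF W] by (auto simp: W_def)
  have y_max: "weight z \<le> weight y" if "rel0 x z" for z
    using Max_ge[OF W(1), of "weight z"] that y(2) by (simp add: W_def)
  define Q where "Q = {z. rel0 x z \<and> weight z = weight y}"
  have Q\<Omega>: "z \<in> \<Omega>" if "z \<in> Q" for z using that rel0_\<Omega> by (auto simp: Q_def)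
  have adv_Q: "adv z \<in> Q" if z: "z \<in> Q" for z
  proof -
    have "rel0 x (adv z)" using z rel0_adv[OF Q\<Omega>[OF z]] rel0_trans by (auto simp: Q_def)
    moreover have "weight z \<le> weight (adv z)"
      using weight_adv_free(1)[OF Q\<Omega>[OF z]] weight_adv_not_free[OF Q\<Omega>[OF z]] by linarith
    ultimately show ?thesis using z y_max[of "adv z"] by (simp add: Q_def)
  qed
  have step: "dig s z = k - 1 \<and> free (dig s (adv z))" if z: "z \<in> Q" "free (dig s z)" for z
  proof -
    have top: "dig s z = k - 1"
      using weight_adv_free(2)[OF Q\<Omega>[OF z(1)] z(2)] adv_Q[OF z(1)] z(1) by (simp add: Q_def)
    have "free (dig s (adv z))"
    proof (rule ccontr)
      assume nf: "\<not> ?thesis"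
      \<comment> \<open>The next inserted digit is free, while the dropped one weighs nothing: a
        strict gain.\<close>
      have "hi (adv z) = m - 1" using weight_adv_free(3)[OF Q\<Omega>[OF z(1)] z(2) top] .
      then have "free (adv z div n)" using free_top_digit[OF dig_less] by (simp add: div_n_eq)
      then have "weight (adv z) < weight (adv (adv z))"
        using weight_adv_not_free[OF Q\<Omega>[OF adv_Q[OF z(1)]] nf] by (simp add: wt_def free_def)
      then show False using adv_Q[OF z(1)] adv_Q[OF adv_Q[OF z(1)]] by (simp add: Q_def)
    qed
    then show ?thesis using top by simp
  qed
  have pow_Q: "(adv ^^ j) z \<in> Q" if "z \<in> Q" for j z using that by (induction j) (auto intro: adv_Q)
  have pow_dig: "dig (l + j) ((adv ^^ j) z) = dig l z" if "z \<in> Q" "l + j \<le> s" for l j z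
    using that
  proof (induction j)
    case (Suc j)
    then show ?case using dig_adv[OF Q\<Omega>[OF pow_Q[OF Suc.prems(1)]], of "l + j" j] by simp
  qed simp
  \<comment> \<open>The free digit of \<open>x\<close> makes the maximal weight positive.\<close>
  have "\<exists>l\<le>s. free (dig l y)"
  proof (rule ccontr)
    assume "\<not> ?thesis"
    then have "weight y = 0" by (simp add: weight_def wt_def)
    moreover have "wt (dig i x) \<le> weight x" unfolding weight_def using i(1) by (intro member_le_sum) auto
    ultimately show False using y_max[OF rel0_refl[OF x]] i(2) by (simp add: wt_def free_def)
  qed
  then obtain l where l: "l \<le> s" "free (dig l y)" by blast
  have yQ: "y \<in> Q" using y(1) by (simp add: Q_def)
  define z where "z = (adv ^^ (s - l)) y"
  have z: "z \<in> Q" "free (dig s z)"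
    using pow_Q[OF yQ] pow_dig[OF yQ, of l "s - l"] l by (simp_all add: z_def)
  \<comment> \<open>Digit \<open>j\<close> of \<open>z\<close> reaches position \<open>s\<close>
    after \<open>s - j\<close> steps.\<close>
  have fr: "free (dig s ((adv ^^ j) z))" for j
    by (induction j) (use z step pow_Q in auto)
  have all: "dig j z = k - 1" if "j \<le> s" for j
    using step[OF pow_Q[OF z(1)] fr, of "s - j"] pow_dig[OF z(1), of j "s - j"] that by simp
  have "put (m - 1) z + 1 = k ^ s * (k * (m - 1) + (k - 1)) + k ^ s"
    using mod_power_all_top[of s z] all by (simp add: put_def)
  also have "\<dots> = k ^ s * (k * (m - 1) + (k - 1) + 1)" by simp
  also have "k * (m - 1) + (k - 1) + 1 = k * m"
    using k_pos m2 by (cases k; cases m) auto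
  finally have "put (m - 1) z = k * n - 1" by (simp add: ac_simps)
  moreover have "rel0 z (put (m - 1) z)"
    using rel0_put_free[OF Q\<Omega>[OF z(1)] _ z(2)] m2 by simp
  ultimately show ?thesis using z(1) rel0_trans by (auto simp: Q_def)
qed

section \<open>Reaching a free digit from a nonzero card\<close>

lemma sigma_small: "b < n \<Longrightarrow> b \<in> \<Omega> \<and> sigma k n b = k * b"
  using sigma_apply[of 0 k b n] Omega_mem[of 0 k b n] k_pos by simp

text \<open>\<open>sigma\<close> multiplies every \<open>b < n\<close> by \<open>k\<close>, so its
  inverse strips trailing zero digits.\<close>

lemma ex_nonmultiple:
  assumes "x \<in> \<Omega>" "x \<noteq> 0" shows "\<exists>u. rel0 x u \<and> u mod k \<noteq> 0"
  using assms
proof (induction x rule: less_induct)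
  case (less x)
  show ?case
  proof (cases "x mod k = 0")
    case True
    then obtain b where b: "x = k * b" by auto
    then have "b < n" using less.prems k_pos by (simp add: Omega_def)
    then have "b \<in> \<Omega>" "rel0 x b"
      using sigma_small[of b] rel0_sigma[of b] rel0_sym b by auto
    moreover have "b < x" "b \<noteq> 0" using b less.prems k3 by auto
    ultimately show ?thesis using less.IH rel0_trans by blast
  qed (use less.prems rel0_refl in blast)
qed

lemma ex_dig_sigma:
  assumes "u \<in> \<Omega>" "j \<le> s" shows "\<exists>z. rel0 u z \<and> dig j z = dig 0 u"
  using assms(2)
proof (induction j)
  case 0 show ?case using rel0_refl[OF assms(1)] by blast
next
  case (Suc j)
  then obtain z where z: "rel0 u z" "dig j z = dig 0 u" by auto
  then have "z \<in> \<Omega>" using rel0_\<Omega> by blast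
  then show ?case
    using z Suc.prems rel0_trans[OF z(1) rel0_sigma] dig_Suc_sigma[of z j] by auto
qed

text \<open>
Here the top part \<open>c\<close> is free modulo the odd number \<open>2 q + 1 = m / d\<close> only. For \<open>d \<ge> 3\<close> the possible
digits produced by \<open>\<sigma>\<close> include three of the same parity, one of which is neither \<open>0\<close> nor \<open>d\<close>.
For \<open>d = 2\<close> one can make \<open>c\<close> odd, and then the inverse of \<open>\<sigma>\<close> produces an odd digit.
\<close>

lemma ex_free_of_half:
  assumes d: "d = r" and half: "2 * d = k" and z: "z \<in> \<Omega>" "dig s z = d"
  shows "\<exists>y i. rel0 z y \<and> i \<le> s \<and> free (dig i y)"
proof -
  define N where "N = 2 * q + 1"
  define c0 where "c0 = hi z mod N"
  have "N * d = (2 * d) * q + d" by (simp add: N_def algebra_simps)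
  also have "\<dots> = m" unfolding half unfolding d by (rule m_eq[symmetric])
  finally have N: "m = N * d" by (rule sym)
  have "odd N" by (simp add: N_def)
  have c0: "c0 < N" by (simp add: c0_def N_def)
  have move: "rel0 z (put (c0 + N * t) z)" and lt: "c0 + N * t < m" if "t < d" for t
  proof -
    show 1: "c0 + N * t < m" unfolding N using mult_add_less[OF c0 that] by simp
    obtain v where v: "v \<in> shifts" "v 0 = 0" "v d = int N" using half_shift half by (auto simp: N_def simp flip: d)
    have "hi z = N * (hi z div N) + c0" by (simp add: c0_def)
    then have "int (hi z) = int N * int (hi z div N) + int c0" by (metis of_nat_add of_nat_mult)
    then have "int (c0 + N * t) = int (hi z) + (int t - int (hi z div N)) * v (dig s z)"
      by (simp add: v(3) z(2) algebra_simps)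
    then show "rel0 z (put (c0 + N * t) z)" using rel0_put[OF v(1,2) z(1) 1] by blast
  qed
  show ?thesis
  proof (cases "d = 2")
    case False
    then have r3: "d \<ge> 3" using half k3 by linarith
    define a0 where "a0 = (k * c0 + d) div m"
    \<comment> \<open>As \<open>k * N = 2 * m\<close>, each increment of \<open>t\<close> raises the
      new digit by exactly \<open>2\<close>.\<close>
    have a: "(k * (c0 + N * t) + d) div m = a0 + 2 * t" for t
    proof -
      have "k * N = 2 * m" using half N by (metis mult.assoc mult.commute)
      then have "k * (c0 + N * t) + d = (k * c0 + d) + (2 * t) * m"
        by (simp add: algebra_simps)
      then have "(k * (c0 + N * t) + d) div m = ((k * c0 + d) + (2 * t) * m) div m" by (simp only:)
      also have "\<dots> = 2 * t + a0" unfolding a0_def by (rule div_mult_self1) (use m2 in simp)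
      finally show ?thesis by simp
    qed
    \<comment> \<open>\<open>t = 1\<close> serves unless it yields the excluded digit
      \<open>d\<close>; then \<open>t = 2\<close> is available since
      \<open>d \<ge> 3\<close>.\<close>
    define t where "t = (if a0 + 2 = d then 2 else 1 :: nat)"
    have t: "t < d" "a0 + 2 * t \<noteq> d" "0 < a0 + 2 * t" using r3 by (auto simp: t_def)
    let ?y = "put (c0 + N * t) z"
    have y: "?y \<in> \<Omega>" using put_\<Omega> lt[OF t(1)] by blast
    have "dig 0 (sigma k n ?y) = a0 + 2 * t"
      using dig_0_sigma[OF y] by (simp add: div_n_eq hi_put dig_put z(2) a)
    moreover have "dig 0 (sigma k n ?y) < k" by (rule dig_less)
    ultimately have "free (dig 0 (sigma k n ?y))" using t by (simp add: free_def flip: d)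
    then show ?thesis using rel0_trans[OF move[OF t(1)] rel0_sigma[OF y]] by blast
  next
    case True
    then have k4: "k = 4" using half by simp
    \<comment> \<open>As \<open>N\<close> is odd, one of \<open>c0\<close> and \<open>c0 + N\<close>
      is odd.\<close>
    define t where "t = (if odd c0 then 0 else 1 :: nat)"
    have t: "t < d" "odd (c0 + N * t)" using \<open>odd N\<close> True by (auto simp: t_def)
    let ?y = "put (c0 + N * t) z"
    have y: "?y \<in> \<Omega>" using put_\<Omega> lt[OF t(1)] by blast
    define w where "w = (?y mod k) * n + ?y div k"
    have "?y div k < n" using y by (simp add: Omega_def less_mult_imp_div_less mult.commute)
    then have w: "w \<in> \<Omega>" "sigma k n w = ?y"
      using Omega_mem[of "?y mod k" k "?y div k" n] sigma_apply[of "?y mod k" k "?y div k" n] k_pos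
      by (simp_all add: w_def)
    have "w div k ^ s = (?y mod k) * m + ?y div k div k ^ s"
      using k_pos by (simp add: w_def mult.left_commute)
    also have "?y div k div k ^ s = c0 + N * t"
      using hi_put[of "c0 + N * t" z] by (simp add: hi_def div_mult2_eq)
    \<comment> \<open>Here \<open>m = 2 * N\<close> is even, so the parity is that of
      \<open>c0 + N * t\<close>; an odd digit below \<open>4\<close> is neither \<open>0\<close> nor
      \<open>2\<close>.\<close>
    finally have "odd (w div k ^ s)" using N True t(2) by simp
    moreover have "even (a mod k) \<longleftrightarrow> even a" for a using k4 by (simp add: dvd_mod_iff)
    ultimately have "odd (dig s w)" by (simp add: dig_def)
    then have "free (dig s w)" using dig_less[of s w] True by (auto simp: free_def intro: odd_pos simp flip: d)
    moreover have "rel0 z w"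
      using rel0_trans[OF move[OF t(1)]] rel0_sym[OF rel0_sigma[OF w(1)]] w(2) by simp
    ultimately show ?thesis by blast
  qed
qed

lemma rel0_top_of_nonzero:
  assumes "x \<in> \<Omega>" "x \<noteq> 0" shows "rel0 x (k * n - 1)"
proof -
  obtain u where u: "rel0 x u" "u mod k \<noteq> 0" using ex_nonmultiple assms by blast
  then have u\<Omega>: "u \<in> \<Omega>" using rel0_\<Omega> by blast
  obtain y i where "rel0 u y" "i \<le> s" "free (dig i y)"
  proof (cases "free (dig 0 u)")
    case True then show ?thesis using that rel0_refl[OF u\<Omega>] by blast
  next
    case False
    then have half: "2 * r = k" "dig 0 u = r" using u(2) k_pos by (auto simp: free_def dig_def)
    obtain z where "rel0 u z" "dig s z = r" using ex_dig_sigma[OF u\<Omega> order_refl] half by auto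
    then show ?thesis using that ex_free_of_half[OF refl half(1)] rel0_trans rel0_\<Omega> by meson
  qed
  then show ?thesis using rel0_top rel0_trans[OF u(1)] rel0_trans rel0_\<Omega> by meson
qed

section \<open>Transitivity and the conclusion\<close>

lemma to_zero:
  assumes "x \<in> \<Omega>" shows "\<exists>g\<in>H. g x = 0"
  using assms
proof (induction x rule: less_induct)
  case (less x)
  show ?case
  proof (cases "x = 0")
    case True
    then show ?thesis using H_id less.prems by metis
  next
    case False
    \<comment> \<open>Rotating the lowest digit of \<open>x\<close> to \<open>0\<close> gives
      \<open>k * b\<close>, which the inverse of \<open>sigma\<close> sends to the smaller card
      \<open>b\<close>.\<close>
    define b where "b = x div k"
    have b: "b < n" "b < x" using less.prems False k3
      by (simp_all add: b_def Omega_def less_mult_imp_div_less mult.commute)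
    obtain g where g: "g \<in> H" "g b = 0" using less.IH[OF b(2)] sigma_small[OF b(1)] by blast
    obtain i where i: "i \<in> H" "\<forall>x\<in>\<Omega>. i (sigma k n x) = x" using H_inv[OF sigma_H] by blast
    have "realized (\<lambda>y. g (i (lift 0 (rot (k - x mod k)) y)))"
      by (rule realized_comp[OF realized_H[OF g(1)] realized_comp[OF realized_H[OF i(1)] realized_lift_rot]]) simp
    moreover have "lift 0 (rot (k - x mod k)) x = sigma k n b"
      using sigma_small[OF b(1)] mod_less_divisor[OF k_pos, of x] by (simp add: lift_def rot_def b_def)
    then have "g (i (lift 0 (rot (k - x mod k)) x)) = 0"
      using i(2) sigma_small[OF b(1)] g(2) by metis
    ultimately show ?thesis using less.prems unfolding realized_def by metis
  qed
qed

end

theorem theorem1p2: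
  fixes k n :: nat
  assumes "k \<ge> 3" and "n \<ge> 1"
    and "\<forall>f::nat. n \<noteq> k ^ f"
  shows "two_transitive_on (H_group k n) (Omega k n)"
proof -
  obtain m where m: "n = k ^ multiplicity k n * m" "\<not> k dvd m"
    using multiplicity_decompose'[of n k] assms by auto
  \<comment> \<open>\<open>m = 1\<close> would make \<open>n\<close> a power of
    \<open>k\<close>.\<close>
  have "m \<noteq> 0" "m \<noteq> 1" using m assms(3) by (metis dvd_0_right, metis mult.right_neutral)
  then interpret shuffle k "multiplicity k n" m
    using assms(1) m(2) by unfold_locales auto
  \<comment> \<open>The reference pair is \<open>(0, k * n - 1)\<close>.\<close>
  show ?thesis
    using two_transitive_onI[OF subgroup_H_group to_zero, of "k * n - 1"]
      rel0_top_of_nonzero by (simp add: rel0_def flip: m(1))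
qed

end
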